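(* Let $d \geq 2$ be an integer, let $c \in \mathbb{Q}$, and let $f(z) = z^d + c$. Suppose that the critical orbit $\{f^n(0) : n \geq 1\}$ is infinite. Then $\#\mathcal{Z}(f,0) \leq 23$.
   Context: Here $f^n$ denotes the $n$-th iterate of $f$. Write $c = \frac{a}{b}$ in lowest terms with $b$ a positive integer. For every $n \geq 1$ one has $f^n(0) = \frac{a_n}{b^{d^{n-1}}}$ in lowest terms, for an integer $a_n$ coprime to $b$; this defines the integer sequence $(a_n)_{n\ge 1}$. The Zsigmondy set $\mathcal{Z}(f,0)$ is the set of indices $n \geq 2$ such that $a_n$ has no primitive prime divisor, i.e. such that for every prime $p$ dividing $a_n$ there exists $1 \leq k < n$ with $p \mid a_k$. *)

theory Defs
  imports Complex_Main "HOL-Computational_Algebra.Primes"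
begin

definition unicrit :: "nat \<Rightarrow> rat \<Rightarrow> rat \<Rightarrow> rat" where
  "unicrit d c z = z ^ d + c"

text \<open>
  The integer \<open>a\<^sub>n\<close>: the numerator of \<open>f\<^sup>n(0)\<close> in lowest terms (with positive denominator).
  Lemma \<open>quotient_of_critical_orbit\<close> below confirms that for \<open>n \<ge> 1\<close> the denominator is
  \<open>b ^ (d ^ (n - 1))\<close>, where \<open>b\<close> is the denominator of \<open>c\<close>.
\<close>
definition crit_num :: "nat \<Rightarrow> rat \<Rightarrow> nat \<Rightarrow> int" where
  "crit_num d c n = fst (quotient_of ((unicrit d c ^^ n) 0))"

definition zsigmondy_set :: "nat \<Rightarrow> rat \<Rightarrow> nat set" where
  "zsigmondy_set d c =
     {n. n \<ge> 2 \<and> (\<forall>p::int. prime p \<and> p dvd crit_num d c n \<longrightarrow>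
                      (\<exists>k. 1 \<le> k \<and> k < n \<and> p dvd crit_num d c k))}"

lemma quotient_of_critical_orbit:
  assumes "d \<ge> 2" and "n \<ge> 1"
  shows "quotient_of ((unicrit d c ^^ n) 0) =
           (crit_num d c n, snd (quotient_of c) ^ (d ^ (n - 1)))"
proof -
  obtain a b where ab: "quotient_of c = (a, b)" by force
  have b: "b > 0" using ab quotient_of_denom_pos by blast
  have cop: "coprime a b" using ab quotient_of_coprime by blast
  have c: "c = of_int a / of_int b" using ab quotient_of_div by blast
  have "\<exists>x. quotient_of ((unicrit d c ^^ Suc m) 0) = (x, b ^ (d ^ m))" for m
  proof (induction m)
    case 0
    show ?case using ab assms(1) by (simp add: unicrit_def power_0_left)
  next
    case (Suc m)
    then obtain x where x: "quotient_of ((unicrit d c ^^ Suc m) 0) = (x, b ^ (d ^ m))" by blast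
    let ?e = "d ^ Suc m"
    let ?y = "x ^ d + a * b ^ (?e - 1)"
    have e: "?e \<ge> 2" using assms(1)
      by (metis le_trans power_increasing power_one_right le_add1 numeral_2_eq_2 plus_1_eq_Suc)
    have cx: "coprime x b"
      using quotient_of_coprime[OF x] assms(1) by simp
    have "b dvd b ^ (?e - 1)" using e by (intro dvd_power) auto
    then obtain t where t: "b ^ (?e - 1) = b * t" by blast
    have "coprime (x ^ d + b * (a * t)) b"
      using cx gcd_add_mult[of b "a * t" "x ^ d"]
      by (simp add: coprime_iff_gcd_eq_1 [symmetric] ac_simps)
    hence cy: "coprime ?y (b ^ ?e)" unfolding t by (simp add: mult.left_commute)
    have be: "b ^ ?e = b * b ^ (?e - 1)" using e by (intro power_minus_mult[symmetric, of ?e b, unfolded mult.commute[of _ b]]) linarith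
    have xx: "(unicrit d c ^^ Suc m) 0 = of_int x / of_int (b ^ (d ^ m))"
      using quotient_of_div[OF x] .
    have "(unicrit d c ^^ Suc (Suc m)) 0 = (of_int x / of_int (b ^ (d ^ m))) ^ d + c"
      using xx by (simp add: unicrit_def)
    also have "\<dots> = of_int x ^ d / of_int (b ^ ?e) + c"
      by (simp add: power_divide mult.commute flip: power_mult)
    also have "\<dots> = of_int ?y / of_int (b ^ ?e)"
      unfolding be c using b by (simp add: field_simps)
    finally have "(unicrit d c ^^ Suc (Suc m)) 0 = Fract ?y (b ^ ?e)"
      by (simp add: Fract_of_int_quotient)
    thus ?case using cy b by (auto simp: quotient_of_Fract Rat.normalize_def Let_def)
  qed
  from this[of "n - 1"] show ?thesis using assms ab by (auto simp: crit_num_def)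
qed

end

theory Submission
  imports Defs
begin

text \<open>
  Write \<open>x\<^sub>n = f\<^sup>n(0)\<close>, with numerator \<open>a\<^sub>n\<close> and denominator \<open>b\<close> to the power \<open>d\<close> to the power \<open>n - 1\<close>.

  The arithmetic input is rigid divisibility. Because \<open>0\<close> is a critical point of order \<open>d \<ge> 2\<close>,
  applying \<open>f\<^sup>j\<close> to \<open>x\<^sub>k\<close> and to \<open>0\<close> gives results that agree up to a multiple of the \<open>d\<close>-th power of
  \<open>a\<^sub>k\<close> (\<open>a_power_dvd_shift\<close>). Hence, if \<open>k\<close> is the first index with \<open>p\<close> dividing \<open>a\<^sub>k\<close>, then \<open>p\<close>
  divides \<open>a\<^sub>n\<close> only for multiples \<open>n\<close> of \<open>k\<close>, and with the same multiplicity each time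
  (\<open>rigid_divisibility\<close>). For an index \<open>n\<close> without primitive prime divisor every such \<open>k\<close> is at most
  \<open>n/2\<close>, so \<open>a\<^sub>n\<close> divides the product of the \<open>a\<^sub>i\<close> with \<open>i \<le> n/2\<close> (\<open>zsigmondy_dvd_prod\<close>). The
  logarithm of \<open>\<bar>a\<^sub>i\<bar>\<close> grows at most like \<open>d\<^sup>i\<close>, so the logarithm of this product is only about the
  square root of that of the denominator of \<open>x\<^sub>n\<close>: if \<open>b \<ge> 2\<close>, the number \<open>x\<^sub>n\<close> must be extremely
  small (\<open>zsigmondy_upper\<close>).

  The rest is real dynamics. If the orbit becomes large early, which happens for \<open>\<bar>c\<bar> \<ge> 3\<close> and
  also when \<open>c\<close> is an integer, then \<open>x\<^sub>n\<close> is not small for any \<open>n \<ge> 9\<close>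
  (\<open>not_zsigmondy_if_escape\<close>). In the remaining case \<open>\<bar>c\<bar> < 3\<close> and \<open>b \<ge> 2\<close>, let \<open>n \<ge> 9\<close> be an
  index without primitive prime divisor. The map \<open>f\<^sup>n\<close> is so flat at the critical point \<open>0\<close> that it
  sends the disk of radius \<open>2\<bar>x\<^sub>n\<bar>\<close> around \<open>0\<close> into the disk of radius \<open>\<bar>x\<^sub>n\<bar>/2\<close> around \<open>x\<^sub>n\<close>.
  The orbit of \<open>0\<close> therefore follows \<open>x\<^sub>1, \<dots>, x\<^sub>n\<close> again and again for ever, and it never
  comes closer to \<open>0\<close> than \<open>\<bar>x\<^sub>n\<bar>/2\<close> (\<open>trapped_orbit_lower\<close>). A later index \<open>m\<close> without primitive
  prime divisor would need \<open>x\<^sub>m\<close> much closer to \<open>0\<close>, since even \<open>x\<^sub>n\<close> is at least the reciprocal of its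
  denominator. So at most one index from \<open>9\<close> on lies in the Zsigmondy set, and the indices from
  \<open>2\<close> to \<open>8\<close> contribute at most seven more.
\<close>

section \<open>Elementary estimates\<close>

text \<open>The Lipschitz bound for the power map that the mean value theorem would give over the reals.\<close>

lemma power_diff_abs_le:
  fixes z w M :: "'a :: linordered_field"
  assumes "\<bar>z\<bar> \<le> M" "\<bar>w\<bar> \<le> M"
  shows "\<bar>z ^ Suc m - w ^ Suc m\<bar> \<le> of_nat (Suc m) * M ^ m * \<bar>z - w\<bar>"
proof -
  have M: "M \<ge> 0" using assms(1) abs_ge_zero order_trans by blast
  have "\<bar>\<Sum>p<Suc m. z ^ p * w ^ (m - p)\<bar> \<le> (\<Sum>p<Suc m. \<bar>z ^ p * w ^ (m - p)\<bar>)"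
    by (rule sum_abs)
  also have "\<dots> \<le> (\<Sum>p<Suc m. M ^ m)"
  proof (rule sum_mono)
    fix p assume "p \<in> {..<Suc m}"
    then have "M ^ m = M ^ p * M ^ (m - p)" by (simp flip: power_add)
    moreover have "\<bar>z\<bar> ^ p * \<bar>w\<bar> ^ (m - p) \<le> M ^ p * M ^ (m - p)"
      using assms M by (intro mult_mono power_mono) auto
    ultimately show "\<bar>z ^ p * w ^ (m - p)\<bar> \<le> M ^ m"
      by (simp add: abs_mult power_abs)
  qed
  also have "\<dots> = of_nat (Suc m) * M ^ m" by simp
  finally have "\<bar>z - w\<bar> * \<bar>\<Sum>p<Suc m. z ^ p * w ^ (m - p)\<bar> \<le> \<bar>z - w\<bar> * (of_nat (Suc m) * M ^ m)"
    by (intro mult_left_mono) auto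
  then show ?thesis
    by (simp add: power_diff_sumr2 abs_mult mult.commute del: sum.lessThan_Suc power_Suc of_nat_Suc)
qed

lemma sum_powers_le_power:
  fixes d :: nat
  assumes "d \<ge> 2"
  shows "(\<Sum>i<N. d ^ i) \<le> d ^ N"
proof (induction N)
  case (Suc N)
  have "(\<Sum>i<Suc N. d ^ i) \<le> 2 * d ^ N" using Suc by simp
  also have "\<dots> \<le> d ^ Suc N" using assms by simp
  finally show ?case .
qed simp

text \<open>
  The next two inequalities between exponents serve different purposes: the first one compares the
  size allowed by rigid divisibility with the height, and for \<open>d = 2\<close> it is what forces \<open>n \<ge> 9\<close>; the
  second one absorbs the Lipschitz constants of the \<open>n\<close> steps of a cycle.
\<close>

lemma half_exponent_le:
  fixes d n :: nat
  assumes "d \<ge> 2" "n \<ge> 9"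
  shows "8 * d ^ (n div 2) \<le> d ^ (n - 2)"
proof -
  have "n div 2 + 5 \<le> n" using assms(2) by linarith
  then obtain t where "n = n div 2 + 5 + t" using le_Suc_ex by blast
  then have t: "n - 2 = 3 + (n div 2 + t)" by linarith
  have "2 ^ 3 * (d ^ (n div 2) * 1) \<le> d ^ 3 * (d ^ (n div 2) * d ^ t)"
    using assms(1) by (intro mult_mono power_mono) auto
  then show ?thesis unfolding t power_add by simp
qed

lemma linear_le_power:
  fixes d n :: nat
  assumes "d \<ge> 2" "n \<ge> 9"
  shows "3 * d * n + d + 1 \<le> d ^ (n - 2)"
proof -
  have *: "3 * n + 2 \<le> d ^ (n - 3)" using assms(2)
  proof (induction n rule: dec_induct)
    case base
    have "(2::nat) ^ 6 \<le> d ^ 6" using assms(1) by (rule power_mono) simp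
    then show ?case by simp
  next
    case (step m)
    have "3 * Suc m + 2 \<le> 2 * (3 * m + 2)" using step by simp
    also have "\<dots> \<le> 2 * d ^ (m - 3)" using step.IH by (rule mult_le_mono2)
    also have "\<dots> \<le> d ^ Suc (m - 3)" using assms(1) by simp
    also have "Suc (m - 3) = Suc m - 3" using step by simp
    finally show ?case .
  qed
  have "3 * d * n + d + 1 \<le> d * (3 * n + 2)" using assms(1) by (simp add: algebra_simps)
  also have "\<dots> \<le> d * d ^ (n - 3)" using * by (rule mult_le_mono2)
  also have "\<dots> = d ^ Suc (n - 3)" by simp
  also have "Suc (n - 3) = n - 2" using assms(2) by simp
  finally show ?thesis .
qed

section \<open>Numerators of the critical orbit\<close>

locale infinite_critical_orbit =
  fixes d :: nat and c :: rat
  assumes degree: "d \<ge> 2"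
    and infinite_orbit: "infinite {(unicrit d c ^^ n) 0 | n. n \<ge> 1}"
begin

definition x :: "nat \<Rightarrow> rat" where "x n = (unicrit d c ^^ n) 0"
definition a :: "nat \<Rightarrow> int" where "a n = crit_num d c n"
definition b :: int where "b = snd (quotient_of c)"

lemma x_0 [simp]: "x 0 = 0" by (simp add: x_def)
lemma x_Suc: "x (Suc n) = x n ^ d + c" by (simp add: x_def unicrit_def)
lemma x_1 [simp]: "x (Suc 0) = c" using degree by (simp add: x_Suc power_0_left)

lemma b_ge_1: "b \<ge> 1"
  using quotient_of_denom_pos'[of c] by (simp add: b_def)

lemma quotient_of_x: "quotient_of (x (Suc n)) = (a (Suc n), b ^ (d ^ n))"
  using quotient_of_critical_orbit[OF degree, of "Suc n" c] by (simp add: x_def a_def b_def)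

lemma x_eq: "x (Suc n) = of_int (a (Suc n)) / of_int b ^ (d ^ n)"
  using quotient_of_div[OF quotient_of_x[of n]] by simp

lemma a_eq: "of_int (a (Suc n)) = x (Suc n) * of_int b ^ (d ^ n)"
  using b_ge_1 by (simp add: x_eq)

lemma coprime_a_b: "coprime (a (Suc n)) b"
  using quotient_of_coprime[OF quotient_of_x[of n]] degree by simp

text \<open>A single repetition would make the orbit eventually periodic, hence finite.\<close>

lemma inj_x: "inj x"
proof -
  have False if "i < j" "x i = x j" for i j
  proof -
    define p where "p = j - i"
    have per: "x (i + k) = x (i + k + p)" for k
      using that by (induction k) (simp_all add: p_def x_Suc)
    have "x n \<in> x ` {..<j}" for n
    proof (induction n rule: less_induct)
      case (less n)
      show ?case
      proof (cases "n < j")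
        case False
        then obtain k where k: "n = j + k" using le_Suc_ex not_less by blast
        then have "n - p = i + k" "n = i + k + p" using that by (simp_all add: p_def)
        then have "x n = x (n - p)" using per[of k] by simp
        then show ?thesis using less[of "n - p"] False that by (simp add: p_def)
      qed simp
    qed
    then have "{(unicrit d c ^^ n) 0 | n. n \<ge> 1} \<subseteq> x ` {..<j}"
      by (auto simp flip: x_def)
    then show False using infinite_orbit finite_surj by blast
  qed
  then show ?thesis by (metis injI linorder_neqE_nat)
qed

lemma x_nonzero: "x (Suc n) \<noteq> 0"
  using inj_x x_0 by (metis injD nat.distinct(1))

lemma a_nonzero: "a (Suc n) \<noteq> 0"
  using x_nonzero[of n] by (auto simp: x_eq)

text \<open>The recursion of the orbit after clearing denominators.\<close>

lemma a_Suc: "a (Suc (Suc n)) = a (Suc n) ^ d + a 1 * b ^ (d ^ Suc n - 1)"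
proof -
  have "d ^ Suc n = Suc (d ^ Suc n - 1)" using degree by simp
  then have e: "rat_of_int b ^ (d ^ Suc n) = of_int b * of_int b ^ (d ^ Suc n - 1)"
    by (metis power_Suc)
  have "rat_of_int (a (Suc (Suc n))) = (x (Suc n) ^ d + c) * of_int b ^ (d ^ Suc n)"
    using a_eq[of "Suc n"] by (simp add: x_Suc)
  also have "\<dots> = (x (Suc n) * of_int b ^ (d ^ n)) ^ d + (c * of_int b) * of_int b ^ (d ^ Suc n - 1)"
    unfolding distrib_right e[symmetric] mult.assoc[of c]
    by (simp add: power_mult_distrib mult.commute flip: power_mult)
  also have "\<dots> = of_int (a (Suc n) ^ d + a 1 * b ^ (d ^ Suc n - 1))"
    using a_eq[of n] a_eq[of 0] by simp
  finally show ?thesis by (simp only: of_int_eq_iff)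
qed

section \<open>Rigid divisibility\<close>

text \<open>
  The integral form of \<open>f\<^sup>j(z) - f\<^sup>j(0)\<close> being divisible by \<open>z\<^sup>d\<close>, at \<open>z = f\<^sup>k(0)\<close>: the power of \<open>b\<close>
  rewrites \<open>f\<^sup>j(0)\<close> over the common denominator \<open>b\<close> to the power \<open>d\<close> to the power \<open>k + j - 1\<close>, with
  \<open>Suc k\<close> and \<open>Suc j\<close> in the roles of \<open>k\<close> and \<open>j\<close>.
  One more application of \<open>f\<close> turns the difference of two numerators into a difference of \<open>d\<close>-th
  powers, which the old difference divides.
\<close>

lemma a_power_dvd_shift:
  "a (Suc k) ^ d dvd a (Suc k + Suc j) - a (Suc j) * b ^ (d ^ (k + Suc j) - d ^ j)"
proof (induction j)
  case 0
  show ?case by (simp add: a_Suc)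
next
  case (Suc j)
  define t where "t = d ^ (k + Suc j) - d ^ j"
  have "d ^ Suc j \<ge> 1" using degree by simp
  moreover have "d ^ Suc j \<le> d ^ (k + Suc (Suc j))"
    using degree by (intro power_increasing) auto
  moreover have e2: "d ^ (k + Suc (Suc j)) - d ^ Suc j = t * d"
    by (simp add: t_def diff_mult_distrib2 mult.commute)
  ultimately have e1: "d ^ (k + Suc (Suc j)) - 1 = (d ^ Suc j - 1) + t * d"
    by linarith
  have step: "X - Y * G dvd (X ^ d + \<alpha> * (\<beta> * G ^ d)) - (Y ^ d + \<alpha> * \<beta>) * G ^ d"
    for X Y G \<alpha> \<beta> :: int
  proof -
    have "(X ^ d + \<alpha> * (\<beta> * G ^ d)) - (Y ^ d + \<alpha> * \<beta>) * G ^ d = X ^ d - (Y * G) ^ d"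
      by (simp add: algebra_simps)
    also have "\<dots> = (X - Y * G) * (\<Sum>i<d. (Y * G) ^ (d - Suc i) * X ^ i)"
      by (rule power_diff_sumr2)
    finally show ?thesis by simp
  qed
  have a1: "a (Suc k + Suc (Suc j)) =
      a (Suc k + Suc j) ^ d + a 1 * (b ^ (d ^ Suc j - 1) * (b ^ t) ^ d)"
    using a_Suc[of "k + Suc j"] e1 by (simp add: power_add flip: power_mult)
  have "a (Suc k) ^ d dvd a (Suc k + Suc j) - a (Suc j) * b ^ t"
    using Suc.IH by (simp only: t_def)
  also have "\<dots> dvd a (Suc k + Suc (Suc j)) - a (Suc (Suc j)) * (b ^ t) ^ d"
    unfolding a1 a_Suc[of j] by (rule step)
  finally show ?case unfolding e2 power_mult .
qed

text \<open>
  Subtracting the first index \<open>k\<close> with \<open>p\<close> dividing \<open>a\<^sub>k\<close> from an index leaves the numerator unchanged,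
  up to powers of \<open>b\<close>, modulo the \<open>d\<close>-th power of \<open>a\<^sub>k\<close>. As \<open>d \<ge> 2\<close>, this modulus sees one power of \<open>p\<close> more than
  \<open>a\<^sub>k\<close> contains, and \<open>p\<close> does not divide \<open>b\<close>; so a descent by \<open>k\<close> decides both claims.
\<close>

lemma rigid_divisibility:
  assumes p: "prime p" and k: "p dvd a (Suc k)"
    and minimal: "\<And>i. i < k \<Longrightarrow> \<not> p dvd a (Suc i)"
    and "p dvd a (Suc m)"
  shows "Suc k dvd Suc m \<and> \<not> p ^ Suc (multiplicity p (a (Suc k))) dvd a (Suc m)"
  using assms(4)
proof (induction m rule: less_induct)
  case (less m)
  let ?e = "multiplicity p (a (Suc k))"
  have e: "?e \<ge> 1"
    by (rule multiplicity_geI) (use p k a_nonzero not_prime_unit in auto)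
  have top: "\<not> p ^ Suc ?e dvd a (Suc k)"
  proof
    assume "p ^ Suc ?e dvd a (Suc k)"
    then have "Suc ?e \<le> ?e" by (rule multiplicity_geI[rotated 2]) (use p a_nonzero not_prime_unit in auto)
    then show False by simp
  qed
  consider "m < k" | "m = k" | "m > k" by linarith
  then show ?case
  proof cases
    case 1
    then show ?thesis using less minimal by blast
  next
    case 2
    then show ?thesis using top by simp
  next
    case 3
    then obtain j where j: "m = k + Suc j" by (metis less_imp_Suc_add add_Suc_right)
    let ?t = "d ^ (k + Suc j) - d ^ j"
    have cop: "coprime p b"
      using k coprime_a_b[of k] by (meson coprime_divisors dvd_refl)
    \<comment> \<open>Here criticality of \<open>0\<close> enters: \<open>e + 1 \<le> d e\<close> as \<open>d \<ge> 2\<close> and \<open>e \<ge> 1\<close>.\<close>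
    have "p ^ Suc ?e dvd (p ^ ?e) ^ d"
    proof -
      have "?e * 2 \<le> ?e * d" using degree by (rule mult_le_mono2)
      then have "Suc ?e \<le> ?e * d" using e by linarith
      then show ?thesis by (simp add: le_imp_power_dvd del: power_Suc flip: power_mult)
    qed
    also have "\<dots> dvd a (Suc k) ^ d"
      by (intro dvd_power_same multiplicity_dvd)
    also have "\<dots> dvd a (Suc m) - a (Suc j) * b ^ ?t"
      using a_power_dvd_shift[of k j] j by simp
    finally have D: "p ^ Suc ?e dvd a (Suc m) - a (Suc j) * b ^ ?t" .
    have transfer: "q dvd a (Suc j)" if "q dvd p ^ Suc ?e" "q dvd a (Suc m)" for q
    proof -
      have "q dvd a (Suc m) - (a (Suc m) - a (Suc j) * b ^ ?t)"
        by (rule dvd_diff[OF that(2) dvd_trans[OF that(1) D]])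
      moreover have "coprime q (b ^ ?t)"
        using cop that(1) coprime_divisors[OF that(1) dvd_refl] by simp
      ultimately show ?thesis by (simp add: coprime_dvd_mult_left_iff)
    qed
    have "p dvd a (Suc j)" using transfer[of p] less.prems by simp
    then have IH: "Suc k dvd Suc j" "\<not> p ^ Suc ?e dvd a (Suc j)"
      using less.IH[of j] j by auto
    have "Suc m = Suc k + Suc j" using j by simp
    then have "Suc k dvd Suc m" using IH(1) by (metis dvd_add dvd_refl)
    then show ?thesis using IH(2) transfer[OF dvd_refl] by blast
  qed
qed

text \<open>
  Each prime of \<open>a\<^sub>n\<close> occurs first at a proper divisor \<open>k\<close> of \<open>n\<close>, so at some \<open>k \<le> n/2\<close>, and there
  already with its full multiplicity.
\<close>

lemma zsigmondy_dvd_prod: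
  assumes "n \<in> zsigmondy_set d c"
  shows "a n dvd (\<Prod>i<n div 2. a (Suc i))"
proof (rule multiplicity_le_imp_dvd)
  obtain m where m: "n = Suc m" using assms by (cases n) (auto simp: zsigmondy_set_def)
  show "a n \<noteq> 0" using a_nonzero m by simp
  have P0: "(\<Prod>i<n div 2. a (Suc i)) \<noteq> 0" using a_nonzero by simp
  fix p :: int assume p: "prime p"
  show "multiplicity p (a n) \<le> multiplicity p (\<Prod>i<n div 2. a (Suc i))"
  proof (cases "p dvd a n")
    case True
    then obtain k' where k': "1 \<le> k'" "k' < n" "p dvd a k'"
      using assms p by (auto simp: zsigmondy_set_def a_def)
    then have ex: "p dvd a (Suc (k' - 1))" by simp
    define k where "k = (LEAST i. p dvd a (Suc i))"
    have k: "p dvd a (Suc k)" unfolding k_def by (rule LeastI, rule ex)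
    have minimal: "\<not> p dvd a (Suc i)" if "i < k" for i
      using that not_less_Least unfolding k_def by blast
    have "k \<le> k' - 1" unfolding k_def by (rule Least_le, rule ex)
    then have "Suc k < n" using k' by linarith
    have rd: "Suc k dvd n" "\<not> p ^ Suc (multiplicity p (a (Suc k))) dvd a n"
      using rigid_divisibility[OF p k minimal, of m] True m by auto
    obtain r where r: "n = Suc k * r" using rd(1) by blast
    have "Suc k * 1 < Suc k * r" using \<open>Suc k < n\<close> unfolding r by (simp only: mult_1_right)
    then have "1 < r" by (simp only: mult_less_cancel1)
    then have "Suc k * 2 \<le> n" unfolding r by (intro mult_le_mono2) linarith
    then have "k < n div 2" using div_le_mono[of "Suc k * 2" n 2] by simp
    then have "a (Suc k) dvd (\<Prod>i<n div 2. a (Suc i))" by (intro dvd_prodI) auto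
    then have "multiplicity p (a (Suc k)) \<le> multiplicity p (\<Prod>i<n div 2. a (Suc i))"
      using P0 by (rule dvd_imp_multiplicity_le)
    moreover have "multiplicity p (a n) \<le> multiplicity p (a (Suc k))"
      using rd(2) multiplicity_dvd' not_less_eq_eq by blast
    ultimately show ?thesis by linarith
  qed (simp add: not_dvd_imp_multiplicity_0)
qed

section \<open>Growth of the orbit\<close>

text \<open>
  The summand \<open>1\<close> on the left makes the induction work: for \<open>u \<ge> T\<close> the gap between \<open>u\<^sup>d\<close> and
  \<open>(u - 1)\<^sup>d\<close> is large enough to absorb the addition of \<open>c\<close>.
\<close>

lemma x_upper:
  assumes "\<bar>c\<bar> + 1 \<le> T"
  shows "\<bar>x (Suc n)\<bar> + 1 \<le> T ^ (d ^ n)"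
proof (induction n)
  case (Suc n)
  define u where "u = T ^ (d ^ n)"
  have T: "T \<ge> 1" using assms by linarith
  have uT: "u \<ge> T" unfolding u_def using T degree by (intro self_le_power) auto
  obtain e where e: "d = Suc e" "e \<ge> 1" using degree by (cases d) auto
  have ue: "u ^ e \<ge> u" using uT T e by (intro self_le_power) auto
  have "\<bar>x (Suc (Suc n))\<bar> \<le> \<bar>x (Suc n)\<bar> ^ d + \<bar>c\<bar>"
    by (subst x_Suc) (metis abs_triangle_ineq power_abs)
  also have "\<bar>x (Suc n)\<bar> ^ d \<le> \<bar>x (Suc n)\<bar> * u ^ e"
    using Suc unfolding e(1) power_Suc u_def by (intro mult_left_mono power_mono) auto
  also have "\<dots> \<le> (u - 1) * u ^ e"
    using Suc uT T unfolding u_def by (intro mult_right_mono) auto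
  finally have "\<bar>x (Suc (Suc n))\<bar> \<le> u ^ d - u ^ e + \<bar>c\<bar>"
    by (simp add: e(1) algebra_simps)
  moreover have "u ^ d = T ^ (d ^ Suc n)" by (simp add: u_def mult.commute flip: power_mult)
  ultimately show ?case using ue uT assms by simp
qed (use assms in simp)

text \<open>
  Once the orbit has left the disk of radius \<open>s + 1\<close> it escapes, doubly exponentially if \<open>s > 1\<close>. The summand
  \<open>1\<close> on the right pays for the addition of \<open>c\<close> in each step.
\<close>

lemma x_lower:
  assumes "s \<ge> 1" "\<bar>c\<bar> \<le> s + 1" "\<bar>x k\<bar> \<ge> s + 1"
  shows "\<bar>x (k + i)\<bar> \<ge> s ^ (d ^ i) + 1"
proof (induction i)
  case (Suc i)
  define u where "u = s ^ (d ^ i)"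
  have us: "u \<ge> s" unfolding u_def using assms degree by (intro self_le_power) auto
  have grow: "(u + 1) ^ Suc m \<ge> u ^ Suc m + 1" for m
  proof (induction m)
    case (Suc m)
    have "(u + 1) * (u ^ Suc m + 1) \<le> (u + 1) * (u + 1) ^ Suc m"
      using Suc us assms by (intro mult_left_mono) auto
    moreover have "u ^ Suc m \<ge> 0" using us assms by simp
    moreover have "(u + 1) * (u ^ Suc m + 1) = u ^ Suc (Suc m) + u ^ Suc m + u + 1"
      by (simp add: algebra_simps)
    ultimately show ?case using us assms unfolding power_Suc[of "u + 1" "Suc m"] by linarith
  qed simp
  obtain e where e: "d = Suc (Suc e)" using degree by (metis add_2_eq_Suc le_iff_add)
  have "u ^ Suc e \<ge> u" using us assms by (intro self_le_power) auto
  moreover have "(u + 1) * (u ^ Suc e + 1) \<le> (u + 1) ^ d"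
    unfolding e power_Suc[of _ "Suc e"] using grow[of e] us assms by (intro mult_left_mono) auto
  ultimately have "u ^ d + 2 * u + 1 \<le> (u + 1) ^ d" by (simp add: e algebra_simps)
  also have "\<dots> \<le> \<bar>x (k + i)\<bar> ^ d"
    using Suc us assms unfolding u_def by (intro power_mono) auto
  also have "\<dots> \<le> \<bar>x (k + Suc i)\<bar> + \<bar>c\<bar>"
    by (simp add: x_Suc flip: power_abs)
  finally have "u ^ d + 1 \<le> \<bar>x (k + Suc i)\<bar>" using us assms by linarith
  moreover have "u ^ d = s ^ (d ^ Suc i)" by (simp add: u_def mult.commute flip: power_mult)
  ultimately show ?case by simp
qed (use assms in simp)

text \<open>
  The bound on \<open>\<bar>a\<^sub>n\<bar>\<close> from the divisibility by the earlier numerators, written with \<open>x\<^sub>n\<close>. The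
  exponent on the right is only about the square root of the one on the left.
\<close>

lemma zsigmondy_upper:
  assumes n: "Suc n \<in> zsigmondy_set d c" and T: "\<bar>c\<bar> + 1 \<le> T"
  shows "\<bar>x (Suc n)\<bar> * of_int b ^ (d ^ n) \<le> (T * of_int b) ^ (d ^ (Suc n div 2))"
proof -
  let ?N = "Suc n div 2"
  let ?B = "of_int b :: rat"
  have B: "?B \<ge> 1" using b_ge_1 by simp
  have TB: "T * ?B \<ge> 1 * 1" using T B by (intro mult_mono) auto
  have "\<bar>a (Suc n)\<bar> dvd \<bar>\<Prod>i<?N. a (Suc i)\<bar>"
    using zsigmondy_dvd_prod[OF n] by simp
  then have "\<bar>a (Suc n)\<bar> \<le> \<bar>\<Prod>i<?N. a (Suc i)\<bar>"
    using a_nonzero by (intro zdvd_imp_le) auto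
  then have "\<bar>rat_of_int (a (Suc n))\<bar> \<le> \<bar>\<Prod>i<?N. rat_of_int (a (Suc i))\<bar>"
    by (metis of_int_abs of_int_le_iff of_int_prod)
  also have "\<dots> = (\<Prod>i<?N. \<bar>x (Suc i)\<bar> * ?B ^ (d ^ i))"
    using B by (simp add: a_eq abs_prod abs_mult)
  also have "\<dots> \<le> (\<Prod>i<?N. (T * ?B) ^ (d ^ i))"
  proof (rule prod_mono)
    fix i
    have "\<bar>x (Suc i)\<bar> * ?B ^ (d ^ i) \<le> T ^ (d ^ i) * ?B ^ (d ^ i)"
      using x_upper[OF T, of i] B by (intro mult_right_mono) auto
    then show "0 \<le> \<bar>x (Suc i)\<bar> * ?B ^ (d ^ i) \<and> \<bar>x (Suc i)\<bar> * ?B ^ (d ^ i) \<le> (T * ?B) ^ (d ^ i)"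
      using B by (simp add: power_mult_distrib)
  qed
  also have "\<dots> = (T * ?B) ^ (\<Sum>i<?N. d ^ i)" by (simp add: power_sum)
  also have "\<dots> \<le> (T * ?B) ^ (d ^ ?N)"
    using TB sum_powers_le_power[OF degree] by (intro power_increasing) auto
  finally show ?thesis using B by (simp add: a_eq abs_mult)
qed

section \<open>Orbits that escape early\<close>

text \<open>
  After an escape at time \<open>k \<le> 3\<close> the absolute value of \<open>x\<^sub>n\<close> exceeds \<open>s\<close> to the power \<open>d\<close> to the power \<open>n - 3\<close>,
  whereas \<open>zsigmondy_upper\<close> with \<open>T = s + 2 \<le> s\<^sup>2\<close> permits only an exponent near \<open>d\<close> to the power \<open>n/2\<close>.
\<close>

lemma not_zsigmondy_if_escape:
  assumes s: "s \<ge> 2" "\<bar>c\<bar> \<le> s + 1" "\<bar>x k\<bar> \<ge> s + 1" and k: "k \<le> 3" and n: "n \<ge> 9"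
  shows "n \<notin> zsigmondy_set d c"
proof
  assume Z: "n \<in> zsigmondy_set d c"
  obtain m where m: "n = Suc m" using n by (cases n) auto
  let ?B = "of_int b :: rat"
  let ?D = "d ^ (n div 2)"
  have B: "?B \<ge> 1" using b_ge_1 by simp
  have "2 * d ^ (n div 2) \<le> d ^ (n - 3)"
  proof -
    have "n div 2 + 4 \<le> n" using n by linarith
    then obtain t where "n = n div 2 + 4 + t" using le_Suc_ex by blast
    then have "n - 3 = Suc (n div 2 + t)" by simp
    moreover have "2 * (d ^ (n div 2) * 1) \<le> d * (d ^ (n div 2) * d ^ t)"
      using degree by (intro mult_mono) auto
    ultimately show ?thesis by (simp add: power_add)
  qed
  also have "d ^ (n - 3) \<le> d ^ (n - k)" using degree k by (intro power_increasing) auto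
  finally have D: "2 * ?D \<le> d ^ (n - k)" .
  have D'': "2 * ?D \<le> d ^ m"
  proof -
    have "d ^ (n - 2) \<le> d ^ m" using degree m by (intro power_increasing) auto
    then show ?thesis using half_exponent_le[OF degree n] by linarith
  qed
  have s2: "s + 2 \<le> s * s" using mult_right_mono[of 2 s s] s by linarith
  have "\<bar>x n\<bar> * ?B ^ (d ^ m) \<le> ((s + 2) * ?B) ^ ?D"
    using zsigmondy_upper[of m "s + 2"] Z s m by simp
  also have "\<dots> \<le> ((s * ?B) ^ 2) ^ ?D"
  proof (rule power_mono)
    have "(s + 2) * ?B \<le> (s * s) * (?B * ?B)"
      using s2 B s mult_mono[of 1 ?B ?B ?B] by (intro mult_mono) auto
    then show "(s + 2) * ?B \<le> (s * ?B) ^ 2" by (simp add: power2_eq_square algebra_simps)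
  qed (use s B in simp)
  also have "\<dots> = s ^ (2 * ?D) * ?B ^ (2 * ?D)"
    by (simp only: power_mult_distrib flip: power_mult)
  also have "\<dots> \<le> s ^ (d ^ (n - k)) * ?B ^ (d ^ m)"
    using D D'' s B by (intro mult_mono power_increasing) auto
  also have "\<dots> < \<bar>x n\<bar> * ?B ^ (d ^ m)"
  proof (rule mult_strict_right_mono)
    show "s ^ (d ^ (n - k)) < \<bar>x n\<bar>"
      using x_lower[of s k "n - k"] s k n by simp
  qed (use B in simp)
  finally show False by simp
qed

text \<open>
  Only \<open>c = \<plusminus>1\<close> and \<open>c = \<plusminus>2\<close> are to be examined. Those whose critical orbit stays in the disk
  of radius \<open>2\<close>, namely \<open>c = -1\<close> with \<open>d\<close> even and \<open>c = -2\<close> with \<open>d = 2\<close>, have a finite orbit.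
\<close>

lemma integral_escape:
  assumes "b = 1" "\<bar>c\<bar> < 3"
  shows "\<exists>k\<le>3. \<bar>x k\<bar> \<ge> 3"
proof -
  have c: "c = of_int (a 1)" using a_eq[of 0] assms by simp
  then have "\<bar>a 1\<bar> < 3" using assms(2) by linarith
  moreover have "a 1 \<noteq> 0" using a_nonzero[of 0] by simp
  ultimately have "a 1 = 1 \<or> a 1 = 2 \<or> a 1 = -1 \<or> a 1 = -2" by linarith
  then consider "c = 1" | "c = 2" | "c = -1" | "c = -2"
    using c by force
  moreover have x2: "x 2 = c ^ d + c" by (simp add: numeral_2_eq_2 x_Suc[of "Suc 0"])
  moreover have x3: "x 3 = x 2 ^ d + c" using x_Suc[of 2] by (simp add: eval_nat_numeral)
  moreover have four: "(2::rat) ^ d \<ge> 4" using power_increasing[of 2 d "2::rat"] degree by simp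
  ultimately show ?thesis
  proof cases
    case 1
    then have "\<bar>x 3\<bar> \<ge> 3" using x2 x3 four by simp
    then show ?thesis by blast
  next
    case 2
    then have "\<bar>x 2\<bar> \<ge> 3" using x2 four by simp
    then show ?thesis by (intro exI[of _ 2]) simp
  next
    case 3
    have "odd d" using x2 x_nonzero[of 1] 3 by (cases "even d") (auto simp: numeral_2_eq_2)
    then have "\<bar>x 3\<bar> \<ge> 3" using x2 x3 3 four by (simp add: power_minus_odd)
    then show ?thesis by blast
  next
    case 4
    have "d \<noteq> 2"
    proof
      assume "d = 2"
      then have "x 2 = x 3" using x2 x3 4 by simp
      then show False using inj_x by (auto dest: injD)
    qed
    then have "(2::rat) ^ d \<ge> 8" using power_increasing[of 3 d "2::rat"] degree by simp
    then have "\<bar>x 2\<bar> \<ge> 3" using x2 4 by (cases "even d") (simp_all add: power_minus_odd)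
    then show ?thesis by (intro exI[of _ 2]) simp
  qed
qed

section \<open>Orbits trapped near an attracting cycle\<close>

text \<open>
  A point of the orbit in the disk of radius \<open>2\<epsilon>\<close> is followed for \<open>n\<close> steps. The first step
  takes it within distance \<open>(2\<epsilon>)\<^sup>d\<close> of \<open>x\<^sub>1 = c\<close>, and each later step expands by at most \<open>d 4\<^sup>d\<close>,
  as both orbits stay in the disk of radius \<open>4\<close>: the reference orbit in radius \<open>3\<close>, the other one
  within distance \<open>1\<close> of it.
\<close>

lemma trapped_disk:
  assumes bounded: "\<And>j. j \<le> n \<Longrightarrow> \<bar>x j\<bar> \<le> 3"
    and contracted: "(of_nat d * 4 ^ d) ^ n * (2 * \<epsilon>) ^ d \<le> \<epsilon> / 2"
    and \<epsilon>: "0 \<le> \<epsilon>" "\<epsilon> \<le> 1"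
    and close: "\<bar>x m\<bar> \<le> 2 * \<epsilon>" and j: "1 \<le> j" "j \<le> n"
  shows "\<bar>x (m + j) - x j\<bar> \<le> \<epsilon> / 2"
proof -
  let ?L = "of_nat d * 4 ^ d :: rat"
  have L: "?L \<ge> 1" using degree mult_mono[of 1 "of_nat d :: rat" 1 "4 ^ d"] by simp
  have small: "?L ^ i * (2 * \<epsilon>) ^ d \<le> \<epsilon> / 2" if "i \<le> n" for i
  proof -
    have "?L ^ i * (2 * \<epsilon>) ^ d \<le> ?L ^ n * (2 * \<epsilon>) ^ d"
      using L that \<epsilon> by (intro mult_right_mono power_increasing) auto
    then show ?thesis using contracted by linarith
  qed
  have "\<bar>x (m + Suc i) - x (Suc i)\<bar> \<le> ?L ^ i * (2 * \<epsilon>) ^ d" if "Suc i \<le> n" for i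
    using that
  proof (induction i)
    case 0
    have "\<bar>x m\<bar> ^ d \<le> (2 * \<epsilon>) ^ d" using close by (intro power_mono) auto
    then show ?case using degree by (simp add: x_Suc power_abs power_0_left)
  next
    case (Suc i)
    obtain e where e: "d = Suc e" using degree by (cases d) auto
    have near: "\<bar>x (m + Suc i) - x (Suc i)\<bar> \<le> ?L ^ i * (2 * \<epsilon>) ^ d" using Suc by simp
    then have "\<bar>x (m + Suc i) - x (Suc i)\<bar> \<le> 1" using small[of i] Suc.prems \<epsilon> by simp
    then have M: "\<bar>x (m + Suc i)\<bar> \<le> 4" "\<bar>x (Suc i)\<bar> \<le> 4" using bounded[of "Suc i"] Suc.prems by auto
    have "\<bar>x (m + Suc (Suc i)) - x (Suc (Suc i))\<bar> = \<bar>x (m + Suc i) ^ d - x (Suc i) ^ d\<bar>"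
      by (simp add: x_Suc)
    also have "\<dots> \<le> of_nat d * 4 ^ e * \<bar>x (m + Suc i) - x (Suc i)\<bar>"
      using power_diff_abs_le[OF M, of e] unfolding e .
    also have "\<dots> \<le> ?L * (?L ^ i * (2 * \<epsilon>) ^ d)"
      using near by (intro mult_mono mult_left_mono) (auto simp: e)
    finally show ?case by (simp add: mult.assoc)
  qed
  from this[of "j - 1"] j have "\<bar>x (m + j) - x j\<bar> \<le> ?L ^ (j - 1) * (2 * \<epsilon>) ^ d" by simp
  also have "\<dots> \<le> \<epsilon> / 2" using j by (intro small) simp
  finally show ?thesis .
qed

text \<open>
  With \<open>\<epsilon> = \<bar>x\<^sub>n\<bar>\<close> the trapping disk is mapped into itself by \<open>f\<^sup>n\<close>, so every point of the orbit is
  within \<open>\<bar>x\<^sub>n\<bar>/2\<close> of one of \<open>x\<^sub>1, \<dots>, x\<^sub>n\<close>, all of which have absolute value at least \<open>\<bar>x\<^sub>n\<bar>\<close>.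
\<close>

lemma trapped_orbit_lower:
  assumes bounded: "\<And>j. j \<le> n \<Longrightarrow> \<bar>x j\<bar> \<le> 3"
    and contracted: "(of_nat d * 4 ^ d) ^ n * (2 * \<bar>x n\<bar>) ^ d \<le> \<bar>x n\<bar> / 2"
    and n: "1 \<le> n" "\<bar>x n\<bar> \<le> 1"
    and smallest: "\<And>j. 1 \<le> j \<Longrightarrow> j \<le> n \<Longrightarrow> \<bar>x n\<bar> \<le> \<bar>x j\<bar>"
    and m: "1 \<le> m"
  shows "\<bar>x m\<bar> \<ge> \<bar>x n\<bar> / 2"
proof -
  have near: "\<bar>x (l + j) - x j\<bar> \<le> \<bar>x n\<bar> / 2" if "\<bar>x l\<bar> \<le> 2 * \<bar>x n\<bar>" "1 \<le> j" "j \<le> n" for l j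
    using trapped_disk[OF bounded contracted _ n(2) that] by simp
  have return: "\<bar>x (k * n)\<bar> \<le> 2 * \<bar>x n\<bar>" for k
  proof (induction k)
    case (Suc k)
    have "\<bar>x (k * n + n) - x n\<bar> \<le> \<bar>x n\<bar> / 2" using near[OF Suc, of n] n by simp
    then have "\<bar>x (k * n + n)\<bar> \<le> 2 * \<bar>x n\<bar>" by linarith
    then show ?case by (simp add: add.commute)
  qed simp
  have "m = (m - 1) div n * n + Suc ((m - 1) mod n)" using m by simp
  moreover have "Suc ((m - 1) mod n) \<le> n" using n by (simp add: Suc_leI)
  ultimately obtain k j where j: "m = k * n + j" "1 \<le> j" "j \<le> n"
    by (metis le_add1 plus_1_eq_Suc)
  show ?thesis using near[OF return[of k] j(2,3)] smallest[OF j(2,3)] unfolding j(1) by linarith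
qed

section \<open>Parameters of absolute value below 3\<close>

text \<open>A nonzero rational number is at least the reciprocal of its denominator.\<close>

lemma x_height_lower: "1 / of_int b ^ (d ^ n) \<le> \<bar>x (Suc n)\<bar>"
proof -
  have "\<bar>a (Suc n)\<bar> \<ge> 1" using a_nonzero[of n] by linarith
  then have "\<bar>rat_of_int (a (Suc n))\<bar> \<ge> 1" by linarith
  then show ?thesis using b_ge_1 by (simp add: x_eq abs_divide divide_right_mono)
qed

lemma bounded_before_bounded:
  assumes "\<bar>c\<bar> \<le> 3" "\<bar>x n\<bar> < 3" "j \<le> n"
  shows "\<bar>x j\<bar> \<le> 3"
proof (rule ccontr)
  assume "\<not> \<bar>x j\<bar> \<le> 3"
  then have "\<bar>x (j + (n - j))\<bar> \<ge> 2 ^ (d ^ (n - j)) + 1" using assms by (intro x_lower) auto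
  moreover have "(2::rat) ^ (d ^ (n - j)) \<ge> 2" using degree by (intro self_le_power) auto
  ultimately show False using assms by simp
qed

text \<open>
  By \<open>zsigmondy_upper\<close> the denominator of \<open>x\<^sub>n\<close>, up to a much smaller power of \<open>b\<close>, can be cancelled
  against \<open>\<bar>x\<^sub>n\<bar>\<close>; the part of it kept here is the denominator of \<open>x\<close> at the preceding index \<open>n - 1\<close>.
  The factor \<open>1/4\<close> leaves room for the factor \<open>2\<close> lost in the trapping argument.
\<close>

lemma zsigmondy_small:
  assumes c: "\<bar>c\<bar> < 3" and b: "b \<ge> 2" and n: "n \<ge> 9" and Z: "n \<in> zsigmondy_set d c"
  shows "\<bar>x n\<bar> * of_int b ^ (d ^ (n - 2)) \<le> 1 / 4"
proof -
  obtain m where m: "n = Suc (Suc m)" using n by (intro that[of "n - 2"]) simp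
  let ?B = "of_int b :: rat"
  let ?D = "d ^ (n div 2)"
  have B: "?B \<ge> 2" using b by simp
  have D: "?D \<ge> 1" using degree by simp
  have "d ^ m + (3 * ?D + 2) \<le> d ^ m + 8 * ?D" using D by linarith
  also have "\<dots> \<le> 2 * d ^ m" using half_exponent_le[OF degree n] m by simp
  also have "\<dots> \<le> d ^ Suc m" using degree by simp
  finally have E: "d ^ m + (3 * ?D + 2) \<le> d ^ Suc m" .
  have B2: "?B ^ 2 \<ge> 4" using power_mono[of 2 ?B 2] B by simp
  have "(\<bar>x n\<bar> * ?B ^ (d ^ m) * 4) * ?B ^ (3 * ?D) \<le> (\<bar>x n\<bar> * ?B ^ (d ^ m) * ?B ^ 2) * ?B ^ (3 * ?D)"
    using B B2 by (intro mult_right_mono mult_left_mono) auto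
  also have "\<dots> = \<bar>x n\<bar> * ?B ^ (d ^ m + (3 * ?D + 2))" by (simp add: power_add power2_eq_square)
  also have "\<dots> \<le> \<bar>x n\<bar> * ?B ^ (d ^ Suc m)"
    using E B by (intro mult_left_mono power_increasing) auto
  also have "\<dots> \<le> (4 * ?B) ^ ?D"
    using zsigmondy_upper[of "Suc m" 4] Z c unfolding m by simp
  also have "\<dots> \<le> (?B ^ 3) ^ ?D"
    using mult_right_mono[OF B2, of ?B] B by (intro power_mono) (auto simp: eval_nat_numeral)
  also have "\<dots> = 1 * ?B ^ (3 * ?D)" by (simp flip: power_mult)
  finally have "\<bar>x n\<bar> * ?B ^ (d ^ m) * 4 \<le> 1"
    by (rule mult_right_le_imp_le) (use B in simp)
  then show ?thesis by (simp add: m)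
qed

text \<open>
  The smallness of \<open>x\<^sub>n\<close> supplies all hypotheses of the trapping argument: it beats the Lipschitz
  constants, it rules out an escape before time \<open>n\<close>, and it puts \<open>\<bar>x\<^sub>n\<bar>\<close> below \<open>\<bar>x\<^sub>j\<bar>\<close> for \<open>j < n\<close>,
  because those points have denominators at most that of \<open>x\<close> at index \<open>n - 1\<close>.
\<close>

lemma zsigmondy_traps_orbit:
  assumes c: "\<bar>c\<bar> < 3" and b: "b \<ge> 2" and n: "n \<ge> 9" and Z: "n \<in> zsigmondy_set d c" and m: "1 \<le> m"
  shows "\<bar>x m\<bar> \<ge> \<bar>x n\<bar> / 2"
proof (rule trapped_orbit_lower[OF _ _ _ _ _ m])
  let ?B = "of_int b :: rat"
  let ?E = "d ^ (n - 2)"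
  have B: "?B \<ge> 2" using b by simp
  have B1: "1 \<le> ?B ^ k" for k using B by simp
  have small: "\<bar>x n\<bar> * ?B ^ ?E \<le> 1 / 4" by (rule zsigmondy_small[OF c b n Z])
  have "\<bar>x n\<bar> * 1 \<le> \<bar>x n\<bar> * ?B ^ ?E" using B1 by (intro mult_left_mono) auto
  with small have n4: "\<bar>x n\<bar> \<le> 1 / 4" by linarith
  then show "\<bar>x n\<bar> \<le> 1" by simp
  show "\<bar>x j\<bar> \<le> 3" if "j \<le> n" for j
    using bounded_before_bounded[OF _ _ that] c n4 by simp
  show "1 \<le> n" using n by simp
  show "\<bar>x n\<bar> \<le> \<bar>x j\<bar>" if j: "1 \<le> j" "j \<le> n" for j
  proof (cases "j = n")
    case False
    have "\<bar>x n\<bar> \<le> 1 / ?B ^ ?E" using small B by (simp add: field_simps)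
    also have "\<dots> \<le> 1 / ?B ^ (d ^ (j - 1))"
      using B degree j False by (intro divide_left_mono power_increasing) auto
    also have "\<dots> \<le> \<bar>x j\<bar>" using x_height_lower[of "j - 1"] j by simp
    finally show ?thesis .
  qed simp
  show "(of_nat d * 4 ^ d) ^ n * (2 * \<bar>x n\<bar>) ^ d \<le> \<bar>x n\<bar> / 2"
  proof -
    \<comment> \<open>One factor \<open>\<bar>x\<^sub>n\<bar>\<close> out of the \<open>d - 1\<close> spare ones suffices to cancel the Lipschitz constant.\<close>
    have "rat_of_nat d \<le> 2 ^ d" using less_exp[of d]
      by (metis less_imp_le of_nat_le_iff of_nat_numeral of_nat_power)
    then have "of_nat d * 4 ^ d \<le> (2 ^ d * 2 ^ (2 * d) :: rat)"
      by (simp add: power_mult)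
    also have "\<dots> = 2 ^ (3 * d)" by (simp flip: power_add)
    finally have L: "(of_nat d * 4 ^ d) ^ n \<le> ((2 ^ (3 * d)) ^ n :: rat)"
      by (intro power_mono) auto
    have "(2 * \<bar>x n\<bar>) ^ d \<le> 2 ^ d * \<bar>x n\<bar> ^ 2"
      using power_decreasing[of 2 d "\<bar>x n\<bar>"] degree n4 by (simp add: power_mult_distrib)
    with L have "(of_nat d * 4 ^ d) ^ n * (2 * \<bar>x n\<bar>) ^ d \<le> (2 ^ (3 * d)) ^ n * (2 ^ d * \<bar>x n\<bar> ^ 2)"
      by (intro mult_mono) auto
    also have "\<dots> = 2 ^ (3 * d * n + d + 1) * \<bar>x n\<bar> * (\<bar>x n\<bar> / 2)"
      by (simp add: power_add power2_eq_square flip: power_mult)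
    also have "\<dots> \<le> ?B ^ ?E * \<bar>x n\<bar> * (\<bar>x n\<bar> / 2)"
    proof (intro mult_right_mono)
      have "(2::rat) ^ (3 * d * n + d + 1) \<le> 2 ^ ?E"
        using linear_le_power[OF degree n] by (intro power_increasing) auto
      also have "\<dots> \<le> ?B ^ ?E" using B by (intro power_mono) auto
      finally show "(2::rat) ^ (3 * d * n + d + 1) \<le> ?B ^ ?E" .
    qed auto
    also have "\<dots> \<le> 1 * (\<bar>x n\<bar> / 2)"
      using small by (intro mult_right_mono) (auto simp: mult.commute)
    finally show ?thesis by simp
  qed
qed

text \<open>
  The index \<open>n\<close> keeps \<open>\<bar>x\<^sub>m\<bar>\<close> above half the reciprocal of the denominator of \<open>x\<^sub>n\<close>, and this
  denominator is at most the one of \<open>x\<close> at index \<open>m - 1\<close>, in contradiction to \<open>zsigmondy_small\<close> at \<open>m\<close>.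
\<close>

lemma zsigmondy_late_unique:
  assumes c: "\<bar>c\<bar> < 3" and b: "b \<ge> 2" and n: "n \<ge> 9" "n \<in> zsigmondy_set d c"
    and m: "m > n" "m \<in> zsigmondy_set d c"
  shows False
proof -
  let ?B = "of_int b :: rat"
  have B: "?B \<ge> 2" using b by simp
  have "1 / ?B ^ (d ^ (m - 2)) \<le> 1 / ?B ^ (d ^ (n - 1))"
    using B degree m n by (intro divide_left_mono power_increasing) auto
  also have "\<dots> \<le> \<bar>x n\<bar>" using x_height_lower[of "n - 1"] n by simp
  also have "\<dots> \<le> 2 * \<bar>x m\<bar>" using zsigmondy_traps_orbit[OF c b n, of m] m by simp
  finally have "1 \<le> 2 * (\<bar>x m\<bar> * ?B ^ (d ^ (m - 2)))" using B by (simp add: field_simps)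
  then show False using zsigmondy_small[OF c b _ m(2)] m n by simp
qed

lemma zsigmondy_le_one_late:
  assumes "n \<ge> 9" "n \<in> zsigmondy_set d c" "m \<ge> 9" "m \<in> zsigmondy_set d c"
  shows "n = m"
proof (cases "\<bar>c\<bar> \<ge> 3")
  case True
  then have "n \<notin> zsigmondy_set d c"
    using assms(1) by (intro not_zsigmondy_if_escape[of "\<bar>c\<bar> - 1" "Suc 0"]) auto
  then show ?thesis using assms by blast
next
  case False
  then have c: "\<bar>c\<bar> < 3" by simp
  show ?thesis
  proof (cases "b = 1")
    case True
    then obtain k where "k \<le> 3" "\<bar>x k\<bar> \<ge> 3" using integral_escape c by blast
    then have "n \<notin> zsigmondy_set d c"
      using assms(1) c by (intro not_zsigmondy_if_escape[of 2 k]) auto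
    then show ?thesis using assms by blast
  next
    case False
    then have "b \<ge> 2" using b_ge_1 by linarith
    then show ?thesis using zsigmondy_late_unique[OF c] assms by (metis linorder_neqE_nat)
  qed
qed

end

section \<open>The bound on the Zsigmondy set\<close>

theorem theorem1p1:
  fixes d :: nat and c :: rat
  assumes "d \<ge> 2"
    and "infinite {(unicrit d c ^^ n) 0 | n. n \<ge> 1}"
  shows "finite (zsigmondy_set d c) \<and> card (zsigmondy_set d c) \<le> 23"
proof -
  interpret infinite_critical_orbit d c
    using assms by unfold_locales
  obtain m where m: "\<And>n. n \<in> zsigmondy_set d c \<Longrightarrow> n \<ge> 9 \<Longrightarrow> n = m"
    using zsigmondy_le_one_late by metis
  have sub: "zsigmondy_set d c \<subseteq> insert m {2..8}"
  proof
    fix n assume n: "n \<in> zsigmondy_set d c"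
    then have "n \<ge> 2" by (simp add: zsigmondy_set_def)
    then show "n \<in> insert m {2..8}" using m[OF n] by (cases "n \<ge> 9") auto
  qed
  have "card (zsigmondy_set d c) \<le> card (insert m {2..8})" using sub by (intro card_mono) auto
  also have "\<dots> \<le> 23" by (simp add: card_insert_if)
  finally show ?thesis using sub finite_subset by blast
qed

end
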